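(* Let $a\in\mathbb{R}^n\setminus\{0\}$, let $b_{\rm m},b_{\rm M}\in\mathbb{R}$ with $b_{\rm m}<b_{\rm M}$, let $\gamma>0$, $\mu>0$, and let $\mathcal{B}:\mathbb{R}^n\to\mathbb{R}\cup\{+\infty\}$ be the barrier function associated with the hyperslab $\{x\in\mathbb{R}^n\mid b_{\rm m}\le a^\top x\le b_{\rm M}\}$, defined by $$(\forall u\in\mathbb{R}^n)\quad \mathcal{B}(u)=\begin{cases}-\ln(b_{\rm M}-a^\top u)-\ln(a^\top u-b_{\rm m}) & \text{if } b_{\rm m}<a^\top u<b_{\rm M},\\ +\infty & \text{otherwise.}\end{cases}$$ Then, for every $x\in\mathbb{R}^n$, the proximity operator $\varphi(x,\mu,\gamma)=\mathrm{prox}_{\gamma\mu\mathcal{B}}(x)$ of $\gamma\mu\mathcal{B}$ at $x$ is given by $$\varphi(x,\mu,\gamma)=x+\frac{\kappa(x,\mu,\gamma)-a^\top x}{\|a\|^2}\,a,$$ where $\kappa(x,\mu,\gamma)$ is the unique solution in $]b_{\rm m},b_{\rm M}[$ of the following cubic equation in $z$: $$0=z^3-(b_{\rm m}+b_{\rm M}+a^\top x)z^2+\big(b_{\rm m}b_{\rm M}+a^\top x(b_{\rm m}+b_{\rm M})-2\gamma\mu\|a\|^2\big)z-b_{\rm m}b_{\rm M}a^\top x+\gamma\mu(b_{\rm m}+b_{\rm M})\|a\|^2.$$ In addition, the Jacobian matrix of $\varphi$ with respect to $x$ and the gradients (derivatives) of $\varphi$ with respect to $\mu$ and $\gamma$ are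 given by $$J_\varphi^{(x)}(x,\mu,\gamma)=\mathbb{I}_n+\frac{1}{\|a\|^2}\left(\frac{(b_{\rm M}-\kappa(x,\mu,\gamma))(b_{\rm m}-\kappa(x,\mu,\gamma))}{\eta(x,\mu,\gamma)}-1\right)aa^\top,$$ $$\nabla_\varphi^{(\mu)}(x,\mu,\gamma)=\frac{-\gamma\,(b_{\rm m}+b_{\rm M}-2\kappa(x,\mu,\gamma))}{\eta(x,\mu,\gamma)}\,a,$$ $$\nabla_\varphi^{(\gamma)}(x,\mu,\gamma)=\frac{-\mu\,(b_{\rm m}+b_{\rm M}-2\kappa(x,\mu,\gamma))}{\eta(x,\mu,\gamma)}\,a,$$ where $$\eta(x,\mu,\gamma)=(b_{\rm M}-\kappa(x,\mu,\gamma))(b_{\rm m}-\kappa(x,\mu,\gamma))-(b_{\rm m}+b_{\rm M}-2\kappa(x,\mu,\gamma))(\kappa(x,\mu,\gamma)-a^\top x)-2\gamma\mu\|a\|^2.$$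
   Context: $\|\cdot\|$ is the Euclidean norm on $\mathbb{R}^n$ and $\mathbb{I}_n\in\mathbb{R}^{n\times n}$ the identity matrix. For a proper, convex, lower semicontinuous function $g:\mathbb{R}^n\to\mathbb{R}\cup\{+\infty\}$ and $t>0$, the proximity operator of $tg$ at $x\in\mathbb{R}^n$ is the unique minimizer $\mathrm{prox}_{tg}(x)=\operatorname{argmin}_{u\in\mathbb{R}^n}\ \frac12\|x-u\|^2+t\,g(u)$. The map $\varphi$ is regarded as a function of $(x,\mu,\gamma)\in\mathbb{R}^n\times\,]0,+\infty[\,\times\,]0,+\infty[$ with values in $\mathbb{R}^n$. $J_\varphi^{(x)}$ denotes its Jacobian matrix with respect to $x$, and $\nabla_\varphi^{(\mu)},\nabla_\varphi^{(\gamma)}\in\mathbb{R}^n$ denote its partial derivatives with respect to the scalars $\mu$ and $\gamma$. *)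

theory Defs
  imports "HOL-Analysis.Analysis"
begin

definition prox_objective :: "real \<Rightarrow> ('a::real_normed_vector \<Rightarrow> ereal) \<Rightarrow> 'a \<Rightarrow> 'a \<Rightarrow> ereal" where
  "prox_objective t g x u = ereal ((1/2) * (norm (x - u))\<^sup>2) + ereal t * g u"

text \<open>
  The proximity operator of \<open>t g\<close>. The definite description is meaningful whenever the minimizer
  exists and is unique, which holds for \<open>t > 0\<close> and \<open>g\<close> proper, convex and lower semicontinuous
  on a Euclidean space.
\<close>
definition prox :: "real \<Rightarrow> ('a::real_normed_vector \<Rightarrow> ereal) \<Rightarrow> 'a \<Rightarrow> 'a" where
  "prox t g x = (THE u. is_arg_min (prox_objective t g x) (\<lambda>_. True) u)"

definition hyperslab_barrier :: "'a::real_inner \<Rightarrow> real \<Rightarrow> real \<Rightarrow> 'a \<Rightarrow> ereal" where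
  "hyperslab_barrier a bm bM u =
     (if bm < a \<bullet> u \<and> a \<bullet> u < bM
      then ereal (- ln (bM - a \<bullet> u) - ln (a \<bullet> u - bm))
      else \<infinity>)"

definition \<phi> :: "'a::real_inner \<Rightarrow> real \<Rightarrow> real \<Rightarrow> 'a \<Rightarrow> real \<Rightarrow> real \<Rightarrow> 'a" where
  "\<phi> a bm bM x \<mu> \<gamma> = prox (\<gamma> * \<mu>) (hyperslab_barrier a bm bM) x"

definition hyperslab_cubic ::
    "'a::real_inner \<Rightarrow> real \<Rightarrow> real \<Rightarrow> 'a \<Rightarrow> real \<Rightarrow> real \<Rightarrow> real \<Rightarrow> real" where
  "hyperslab_cubic a bm bM x \<mu> \<gamma> z =
     z^3 - (bm + bM + a \<bullet> x) * z\<^sup>2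
     + (bm * bM + (a \<bullet> x) * (bm + bM) - 2 * \<gamma> * \<mu> * (norm a)\<^sup>2) * z
     - bm * bM * (a \<bullet> x) + \<gamma> * \<mu> * (bm + bM) * (norm a)\<^sup>2"

definition \<kappa> :: "'a::real_inner \<Rightarrow> real \<Rightarrow> real \<Rightarrow> 'a \<Rightarrow> real \<Rightarrow> real \<Rightarrow> real" where
  "\<kappa> a bm bM x \<mu> \<gamma> =
     (THE z. z \<in> {bm<..<bM} \<and> 0 = hyperslab_cubic a bm bM x \<mu> \<gamma> z)"

definition \<eta> :: "'a::real_inner \<Rightarrow> real \<Rightarrow> real \<Rightarrow> 'a \<Rightarrow> real \<Rightarrow> real \<Rightarrow> real" where
  "\<eta> a bm bM x \<mu> \<gamma> =
     (let k = \<kappa> a bm bM x \<mu> \<gamma> in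
        (bM - k) * (bm - k) - (bm + bM - 2 * k) * (k - a \<bullet> x) - 2 * \<gamma> * \<mu> * (norm a)\<^sup>2)"

end

theory Submission
  imports Defs
begin

text \<open>
  The barrier depends on \<open>u\<close> only through \<open>a \<bullet> u\<close>, so the proximal point is \<open>x\<close> moved along \<open>a\<close>, and
  everything reduces to the proximity operator of the scalar barrier
  \<open>\<beta> z = - ln (bM - z) - ln (z - bm)\<close> with step \<open>c = \<gamma> * \<mu> * (norm a)\<^sup>2\<close>. Its optimality condition at
  \<open>s = a \<bullet> x\<close> is \<open>z + c * \<beta>' z = s\<close>, which becomes the cubic equation after multiplication by
  \<open>(z - bm) * (z - bM)\<close>.

  Existence of a root is the intermediate value theorem for the cubic. Uniqueness and continuous
  dependence on \<open>(s, c)\<close> both come from the monotonicity of \<open>\<beta>'\<close>, in the shape of the estimate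
  \<open>critical_point_dist_le\<close>. That the root yields the unique minimizer is a strong convexity
  estimate (\<open>prox_objective_barrier_growth\<close>): the tangent inequality for \<open>ln\<close> bounds the
  objective from below by its value at the candidate plus half the squared distance.

  The derivatives are obtained jointly in \<open>(s, c)\<close>. For \<open>c > 0\<close> the map \<open>(s, c) \<mapsto> (z, c)\<close>, where \<open>z\<close> is
  the root, is a continuous right inverse of the explicit map \<open>(z, c) \<mapsto> (z + c * \<beta>' z, c)\<close>, whose
  derivative is triangular with diagonal entries \<open>1 + c * \<beta>'' z \<ge> 1\<close> and \<open>1\<close>. The inverse function
  rule gives the derivative of the root, and the chain rule then gives all three formulas, because
  \<open>\<eta>\<close> is \<open>(bM - z) * (bm - z) * (1 + c * \<beta>'' z)\<close> at the root.
\<close>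

section \<open>The scalar optimality condition\<close>

definition barrier_deriv :: "real \<Rightarrow> real \<Rightarrow> real \<Rightarrow> real" where
  "barrier_deriv bm bM z = 1 / (bM - z) - 1 / (z - bm)"

definition barrier_deriv2 :: "real \<Rightarrow> real \<Rightarrow> real \<Rightarrow> real" where
  "barrier_deriv2 bm bM z = 1 / (bM - z)\<^sup>2 + 1 / (z - bm)\<^sup>2"

lemma barrier_deriv2_nonneg: "0 \<le> barrier_deriv2 bm bM z"
  by (simp add: barrier_deriv2_def)

lemma has_real_derivative_barrier_deriv:
  assumes "z \<in> {bm<..<bM}"
  shows "(barrier_deriv bm bM has_real_derivative barrier_deriv2 bm bM z) (at z)"
proof -
  have "((\<lambda>z. 1 / (bM - z) - 1 / (z - bm)) has_real_derivative barrier_deriv2 bm bM z) (at z)"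
    using assms unfolding barrier_deriv2_def
    by (auto intro!: derivative_eq_intros simp: power2_eq_square)
  then show ?thesis
    by (simp add: barrier_deriv_def[abs_def])
qed

lemma barrier_deriv_mono:
  assumes "z \<in> {bm<..<bM}" "w \<in> {bm<..<bM}" "z \<le> w"
  shows "barrier_deriv bm bM z \<le> barrier_deriv bm bM w"
proof -
  have "1 / (bM - z) \<le> 1 / (bM - w)" "1 / (w - bm) \<le> 1 / (z - bm)"
    using assms by (auto intro!: divide_left_mono mult_pos_pos)
  then show ?thesis
    by (simp add: barrier_deriv_def)
qed

lemma cubic_eq_optimality_condition:
  fixes s c :: real
  assumes "z \<in> {bm<..<bM}"
  shows "z^3 - (bm + bM + s) * z\<^sup>2 + (bm * bM + s * (bm + bM) - 2 * c) * z
           - bm * bM * s + c * (bm + bM)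
         = (z - bm) * (z - bM) * (z + c * barrier_deriv bm bM z - s)"
proof -
  have "(z - bm) * (z - bM) * barrier_deriv bm bM z = bm + bM - 2 * z"
    using assms by (simp add: barrier_deriv_def divide_simps) (simp add: algebra_simps)
  then have "(z - bm) * (z - bM) * (z + c * barrier_deriv bm bM z - s)
               = (z - bm) * (z - bM) * (z - s) + c * (bm + bM - 2 * z)"
    by (metis (no_types, opaque_lifting) add_diff_eq diff_add_eq distrib_left mult.left_commute)
  then show ?thesis
    by (simp add: algebra_simps power3_eq_cube power2_eq_square)
qed

lemma ex_critical_point:
  fixes s c :: real
  assumes "bm < bM" "c > 0"
  shows "\<exists>z \<in> {bm<..<bM}. z + c * barrier_deriv bm bM z = s"
proof -
  define p where "p z = z^3 - (bm + bM + s) * z\<^sup>2 + (bm * bM + s * (bm + bM) - 2 * c) * z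
           - bm * bM * s + c * (bm + bM)" for z
  have bm: "p bm = c * (bM - bm)" and bM: "p bM = - (c * (bM - bm))"
    by (simp_all add: p_def algebra_simps power3_eq_cube power2_eq_square)
  have ends: "p bm > 0" "p bM < 0"
    unfolding bm bM using assms by simp_all
  have "continuous_on {bm..bM} p"
    unfolding p_def by (intro continuous_intros)
  then obtain z where z: "bm \<le> z" "z \<le> bM" "p z = 0"
    using IVT2'[of p bM 0 bm] ends assms by auto
  with ends have "z \<in> {bm<..<bM}"
    by (cases "z = bm"; cases "z = bM") auto
  with z show ?thesis
    using cubic_eq_optimality_condition[of z bm bM s c] by (auto simp: p_def)
qed

text \<open>
  Subtracting the two equations shows that the quantity on the right is the absolute value of
  \<open>(z' - z) + c' * (\<beta>' z' - \<beta>' z)\<close>. The second summand has the sign of \<open>z' - z\<close> because \<open>\<beta>'\<close> is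
  increasing, so it can be dropped. The case \<open>s' = s\<close>, \<open>c' = c\<close> is uniqueness.
\<close>
lemma critical_point_dist_le:
  fixes s c s' c' :: real
  assumes "z \<in> {bm<..<bM}" "z' \<in> {bm<..<bM}" "c' > 0"
    and z: "z + c * barrier_deriv bm bM z = s"
    and z': "z' + c' * barrier_deriv bm bM z' = s'"
  shows "\<bar>z' - z\<bar> \<le> \<bar>(s' - s) - (c' - c) * barrier_deriv bm bM z\<bar>"
proof -
  have eq: "(s' - s) - (c' - c) * barrier_deriv bm bM z
              = (z' - z) + c' * (barrier_deriv bm bM z' - barrier_deriv bm bM z)"
    using z z' by (simp add: algebra_simps)
  show ?thesis
  proof (cases "z \<le> z'")
    case True
    then have "0 \<le> c' * (barrier_deriv bm bM z' - barrier_deriv bm bM z)"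
      using barrier_deriv_mono[of z bm bM z'] assms by simp
    with True show ?thesis
      unfolding eq by linarith
  next
    case False
    then have "c' * (barrier_deriv bm bM z' - barrier_deriv bm bM z) \<le> 0"
      using barrier_deriv_mono[of z' bm bM z] assms by (simp add: mult_nonneg_nonpos)
    with False show ?thesis
      unfolding eq by linarith
  qed
qed

lemma ex1_critical_point:
  fixes s c :: real
  assumes "bm < bM" "c > 0"
  shows "\<exists>!z. z \<in> {bm<..<bM} \<and> z + c * barrier_deriv bm bM z = s"
proof (rule ex_ex1I)
  show "\<exists>z. z \<in> {bm<..<bM} \<and> z + c * barrier_deriv bm bM z = s"
    using ex_critical_point[OF assms] by blast
  show "z = w" if "z \<in> {bm<..<bM} \<and> z + c * barrier_deriv bm bM z = s"
      "w \<in> {bm<..<bM} \<and> w + c * barrier_deriv bm bM w = s" for z w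
    using critical_point_dist_le[of w bm bM z c c s s] that assms by simp
qed

definition scalar_prox :: "real \<Rightarrow> real \<Rightarrow> real \<Rightarrow> real \<Rightarrow> real" where
  "scalar_prox bm bM s c = (THE z. z \<in> {bm<..<bM} \<and> z + c * barrier_deriv bm bM z = s)"

lemma scalar_prox:
  assumes "bm < bM" "c > 0"
  shows scalar_prox_in_interval: "scalar_prox bm bM s c \<in> {bm<..<bM}"
    and scalar_prox_optimality:
      "scalar_prox bm bM s c + c * barrier_deriv bm bM (scalar_prox bm bM s c) = s"
  using theI'[OF ex1_critical_point[OF assms, of s]] unfolding scalar_prox_def by blast+

section \<open>Differentiability of the scalar proximity operator\<close>

text \<open>The bound of \<open>critical_point_dist_le\<close> is the modulus of an affine function of \<open>(s', c')\<close> and vanishes at \<open>(s, c)\<close>.\<close>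
lemma continuous_scalar_prox:
  assumes "bm < bM" "c > 0"
  shows "continuous (at (s, c)) (\<lambda>p. scalar_prox bm bM (fst p) (snd p))"
proof -
  define k where "k = scalar_prox bm bM s c"
  define bound where "bound p = \<bar>(fst p - s) - (snd p - c) * barrier_deriv bm bM k\<bar>" for p :: "real \<times> real"
  have "continuous (at (s, c)) bound"
    unfolding bound_def by (intro continuous_intros)
  then have lim: "(bound \<longlongrightarrow> 0) (at (s, c))"
    by (simp add: continuous_at bound_def)
  have "open {p :: real \<times> real. snd p > 0}"
    by (intro open_Collect_less continuous_intros)
  then have "\<forall>\<^sub>F p in at (s, c). snd p > 0"
    using assms eventually_at_in_open'[of "{p :: real \<times> real. snd p > 0}" "(s, c)"] by auto
  then have "\<forall>\<^sub>F p in at (s, c). norm (scalar_prox bm bM (fst p) (snd p) - k) \<le> bound p"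
  proof eventually_elim
    case (elim p)
    then show ?case
      unfolding bound_def k_def real_norm_def
      by (intro critical_point_dist_le scalar_prox assms)
  qed
  then have "((\<lambda>p. scalar_prox bm bM (fst p) (snd p) - k) \<longlongrightarrow> 0) (at (s, c))"
    using lim by (rule Lim_null_comparison)
  then show ?thesis
    using Lim_null by (auto simp: continuous_at k_def)
qed

text \<open>
  The inverse function rule needs a map between spaces of the same dimension, so the parameter \<open>c\<close> is
  carried along as a second component and projected away at the end.
\<close>
lemma has_derivative_scalar_prox:
  fixes s c :: real
  assumes "bm < bM" "c > 0"
  defines "k \<equiv> scalar_prox bm bM s c"
  shows "((\<lambda>p. scalar_prox bm bM (fst p) (snd p)) has_derivative
           (\<lambda>(ds, dc). (ds - barrier_deriv bm bM k * dc) / (1 + c * barrier_deriv2 bm bM k)))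
         (at (s, c))"
proof -
  define r D where "r = barrier_deriv bm bM k" and "D = 1 + c * barrier_deriv2 bm bM k"
  define f where "f p = (fst p + snd p * barrier_deriv bm bM (fst p), snd p)" for p :: "real \<times> real"
  define g where "g p = (scalar_prox bm bM (fst p) (snd p), snd p)" for p :: "real \<times> real"
  define g' where "g' p = ((fst p - r * snd p) / D, snd p)" for p :: "real \<times> real"
  have D: "D > 0"
    unfolding D_def using barrier_deriv2_nonneg[of bm bM k] assms by (simp add: add_pos_nonneg)
  have gsc: "g (s, c) = (k, c)"
    by (simp add: g_def k_def)
  have "(barrier_deriv bm bM has_derivative (*) (barrier_deriv2 bm bM k)) (at k)"
    using has_real_derivative_barrier_deriv[of k bm bM] scalar_prox(1)[OF assms(1,2)]
    by (simp add: k_def has_field_derivative_def)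
  then have comp: "((\<lambda>p. barrier_deriv bm bM (fst p)) has_derivative
      (\<lambda>h. barrier_deriv2 bm bM k * fst h)) (at (k, c))"
    using has_derivative_compose[OF has_derivative_fst[OF has_derivative_ident],
        of "barrier_deriv bm bM" _ "(k, c)" UNIV]
    by simp
  have "(g has_derivative g') (at (s, c))"
  proof (rule has_derivative_inverse_basic[where T = "{p. snd p > 0}"])
    show "(f has_derivative (\<lambda>h. (D * fst h + r * snd h, snd h))) (at (g (s, c)))"
      unfolding f_def gsc
      by (rule derivative_eq_intros comp refl | simp add: D_def r_def fun_eq_iff algebra_simps)+
    show "bounded_linear g'"
      unfolding g'_def
      by (intro bounded_linear_Pair bounded_linear_snd
          bounded_linear_compose[OF bounded_linear_divide] bounded_linear_sub bounded_linear_fst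
          bounded_linear_compose[OF bounded_linear_mult_right])
    show "g' \<circ> (\<lambda>h. (D * fst h + r * snd h, snd h)) = id"
      using D by (simp add: g'_def fun_eq_iff)
    show "continuous (at (s, c)) g"
      unfolding g_def by (intro continuous_intros continuous_scalar_prox assms)
    show "open {p :: real \<times> real. snd p > 0}"
      by (intro open_Collect_less continuous_intros)
    show "(s, c) \<in> {p. snd p > 0}"
      using assms by simp
    show "f (g p) = p" if "p \<in> {p. snd p > 0}" for p
      using scalar_prox(2)[OF assms(1), of "snd p" "fst p"] that by (simp add: f_def g_def)
  qed
  from has_derivative_fst[OF this] show ?thesis
    by (simp add: g_def g'_def r_def D_def case_prod_unfold)
qed

section \<open>The proximity operator of the hyperslab barrier\<close>

lemma hyperslab_cubic_root_iff:
  assumes "z \<in> {bm<..<bM}"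
  shows "0 = hyperslab_cubic a bm bM x \<mu> \<gamma> z \<longleftrightarrow>
         z + \<gamma> * \<mu> * (norm a)\<^sup>2 * barrier_deriv bm bM z = a \<bullet> x"
proof -
  have "hyperslab_cubic a bm bM x \<mu> \<gamma> z
      = (z - bm) * (z - bM) * (z + \<gamma> * \<mu> * (norm a)\<^sup>2 * barrier_deriv bm bM z - a \<bullet> x)"
    unfolding cubic_eq_optimality_condition[OF assms, symmetric] hyperslab_cubic_def
    by (simp add: algebra_simps)
  then show ?thesis
    using assms by auto
qed

lemma kappa_eq_scalar_prox: "\<kappa> a bm bM x \<mu> \<gamma> = scalar_prox bm bM (a \<bullet> x) (\<gamma> * \<mu> * (norm a)\<^sup>2)"
  unfolding \<kappa>_def scalar_prox_def
  by (intro arg_cong[where f = The] ext conj_cong refl hyperslab_cubic_root_iff)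

text \<open>
  The objective grows quadratically around the candidate point. The tangent inequality for \<open>ln\<close>
  replaces the barrier by its linearization at \<open>k\<close>, and the optimality condition makes the linear
  term cancel against the cross term of the squared norms.
\<close>
lemma prox_objective_barrier_growth:
  fixes a x u :: "'a::real_inner"
  assumes "a \<noteq> 0" "t > 0" and k: "k \<in> {bm<..<bM}"
    and opt: "k + t * (norm a)\<^sup>2 * barrier_deriv bm bM k = a \<bullet> x"
  defines "p \<equiv> x + ((k - a \<bullet> x) / (norm a)\<^sup>2) *\<^sub>R a"
  shows "prox_objective t (hyperslab_barrier a bm bM) x p + ereal ((1/2) * (norm (u - p))\<^sup>2)
         \<le> prox_objective t (hyperslab_barrier a bm bM) x u"
proof (cases "a \<bullet> u \<in> {bm<..<bM}")
  case False
  then show ?thesis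
    using \<open>t > 0\<close> by (auto simp: prox_objective_def hyperslab_barrier_def)
next
  case True
  define v where "v = a \<bullet> u"
  have na: "(norm a)\<^sup>2 > 0" and aa: "a \<bullet> a = (norm a)\<^sup>2"
    using assms by (simp_all add: power2_norm_eq_inner)
  have ap: "a \<bullet> p = k"
    using na by (simp add: p_def inner_add_right aa)
  have tangent: "- ln w \<ge> - ln w0 - (w - w0) / w0" if "w > 0" "w0 > 0" for w w0 :: real
    using ln_le_minus_one[of "w / w0"] that by (simp add: ln_div diff_divide_distrib)
  have "- ln (bM - v) - ln (v - bm) \<ge> (- ln (bM - k) - ln (k - bm)) + barrier_deriv bm bM k * (v - k)"
  proof -
    have "- ln (bM - v) \<ge> - ln (bM - k) - (k - v) / (bM - k)"
      "- ln (v - bm) \<ge> - ln (k - bm) - (v - k) / (k - bm)"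
      using tangent[of "bM - v" "bM - k"] tangent[of "v - bm" "k - bm"] True k by (auto simp: v_def)
    moreover have "barrier_deriv bm bM k * (v - k) = - ((k - v) / (bM - k)) - (v - k) / (k - bm)"
      by (simp add: barrier_deriv_def algebra_simps diff_divide_distrib)
    ultimately show ?thesis
      by linarith
  qed
  then have barrier: "t * (- ln (bM - v) - ln (v - bm))
      \<ge> t * (- ln (bM - k) - ln (k - bm)) + t * barrier_deriv bm bM k * (v - k)"
    using mult_left_mono[of _ _ t] \<open>t > 0\<close> by (metis distrib_left less_imp_le mult.assoc)
  have "(norm (x - u))\<^sup>2 = (norm (x - p))\<^sup>2 + (norm (u - p))\<^sup>2 - 2 * ((x - p) \<bullet> (u - p))"
    by (simp add: power2_norm_eq_inner inner_diff_left inner_diff_right inner_commute)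
  moreover have "x - p = (t * barrier_deriv bm bM k) *\<^sub>R a"
    using na opt by (simp add: p_def field_simps flip: scaleR_minus_left)
  then have "(x - p) \<bullet> (u - p) = t * barrier_deriv bm bM k * (v - k)"
    by (simp add: inner_diff_right ap v_def right_diff_distrib)
  ultimately have "(1/2) * (norm (x - p))\<^sup>2 + t * (- ln (bM - k) - ln (k - bm)) + (1/2) * (norm (u - p))\<^sup>2
      \<le> (1/2) * (norm (x - u))\<^sup>2 + t * (- ln (bM - v) - ln (v - bm))"
    using barrier by linarith
  then show ?thesis
    using True k by (simp add: prox_objective_def hyperslab_barrier_def ap v_def)
qed

lemma is_arg_min_hyperslab_barrier_iff:
  fixes a x u :: "'a::real_inner"
  assumes "a \<noteq> 0" "t > 0" "k \<in> {bm<..<bM}"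
    and "k + t * (norm a)\<^sup>2 * barrier_deriv bm bM k = a \<bullet> x"
  shows "is_arg_min (prox_objective t (hyperslab_barrier a bm bM) x) (\<lambda>_. True) u \<longleftrightarrow>
         u = x + ((k - a \<bullet> x) / (norm a)\<^sup>2) *\<^sub>R a"
proof -
  define p where "p = x + ((k - a \<bullet> x) / (norm a)\<^sup>2) *\<^sub>R a"
  define F where "F = prox_objective t (hyperslab_barrier a bm bM) x"
  have "a \<bullet> p = k"
    using assms by (simp add: p_def inner_add_right power2_norm_eq_inner)
  then have fin: "\<bar>F p\<bar> \<noteq> \<infinity>"
    using assms by (simp add: F_def prox_objective_def hyperslab_barrier_def)
  have growth: "F p + ereal ((1/2) * (norm (u - p))\<^sup>2) \<le> F u" for u
    unfolding F_def p_def by (rule prox_objective_barrier_growth[OF assms])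
  have less: "F p < F u" if "u \<noteq> p" for u
  proof -
    have "F p < F p + ereal ((1/2) * (norm (u - p))\<^sup>2)"
      using fin that by (cases "F p") auto
    then show ?thesis
      using growth[of u] by (rule less_le_trans)
  qed
  have "is_arg_min F (\<lambda>_. True) u \<longleftrightarrow> u = p"
    using less by (metis is_arg_min_def less_asym)
  then show ?thesis
    by (simp add: F_def p_def)
qed

lemma phi_eq_scalar_prox:
  fixes a x :: "'a::real_inner"
  assumes "a \<noteq> 0" "bm < bM" "\<gamma> * \<mu> > 0"
  defines "k \<equiv> scalar_prox bm bM (a \<bullet> x) (\<gamma> * \<mu> * (norm a)\<^sup>2)"
  shows is_arg_min_iff_eq_phi:
      "is_arg_min (prox_objective (\<gamma> * \<mu>) (hyperslab_barrier a bm bM) x) (\<lambda>_. True) u \<longleftrightarrow>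
         u = \<phi> a bm bM x \<mu> \<gamma>"
    and phi_eq: "\<phi> a bm bM x \<mu> \<gamma> = x + ((k - a \<bullet> x) / (norm a)\<^sup>2) *\<^sub>R a"
proof -
  have c: "\<gamma> * \<mu> * (norm a)\<^sup>2 > 0"
    using assms by simp
  have *: "is_arg_min (prox_objective (\<gamma> * \<mu>) (hyperslab_barrier a bm bM) x) (\<lambda>_. True) u \<longleftrightarrow>
         u = x + ((k - a \<bullet> x) / (norm a)\<^sup>2) *\<^sub>R a" for u
    unfolding k_def
    by (intro is_arg_min_hyperslab_barrier_iff scalar_prox[OF assms(2) c] assms)
  show phi: "\<phi> a bm bM x \<mu> \<gamma> = x + ((k - a \<bullet> x) / (norm a)\<^sup>2) *\<^sub>R a"
    unfolding \<phi>_def prox_def * by simp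
  show "is_arg_min (prox_objective (\<gamma> * \<mu>) (hyperslab_barrier a bm bM) x) (\<lambda>_. True) u \<longleftrightarrow>
         u = \<phi> a bm bM x \<mu> \<gamma>"
    unfolding * phi ..
qed

section \<open>Derivatives of the proximity operator\<close>

text \<open>
  Up to the factor \<open>(bM - k) * (bm - k)\<close> that was used to clear denominators in the cubic, \<open>\<eta>\<close> is the
  derivative of the optimality condition; the identity uses that \<open>k\<close> is a root.
\<close>
lemma eta_eq:
  fixes a x :: "'a::real_inner"
  assumes "a \<noteq> 0" "bm < bM" "\<gamma> * \<mu> > 0"
  defines "c \<equiv> \<gamma> * \<mu> * (norm a)\<^sup>2"
  defines "k \<equiv> scalar_prox bm bM (a \<bullet> x) c"
  shows "\<eta> a bm bM x \<mu> \<gamma> = (bM - k) * (bm - k) * (1 + c * barrier_deriv2 bm bM k)"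
proof -
  have c: "c > 0"
    using assms by simp
  have k: "k \<noteq> bm" "k \<noteq> bM" and opt: "k - a \<bullet> x = - c * barrier_deriv bm bM k"
    using scalar_prox[OF assms(2) c, of "a \<bullet> x"] by (auto simp: k_def)
  have "\<eta> a bm bM x \<mu> \<gamma> = (bM - k) * (bm - k) - (bm + bM - 2 * k) * (k - a \<bullet> x) - 2 * c"
    by (simp add: \<eta>_def kappa_eq_scalar_prox Let_def k_def c_def)
  also have "\<dots> = (bM - k) * (bm - k) + c * ((bm + bM - 2 * k) * barrier_deriv bm bM k - 2)"
    unfolding opt by (simp add: algebra_simps)
  also have "(bm + bM - 2 * k) * barrier_deriv bm bM k - 2 = (bM - k) * (bm - k) * barrier_deriv2 bm bM k"
  proof -
    have "(p - q) * (1 / p - 1 / q) - 2 = - (p * q) * (1 / p\<^sup>2 + 1 / q\<^sup>2)"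
      if "p \<noteq> 0" "q \<noteq> 0" for p q :: real
      using that by (simp add: divide_simps power2_eq_square) (simp add: algebra_simps)
    from this[of "bM - k" "k - bm"] show ?thesis
      using k by (simp add: barrier_deriv_def barrier_deriv2_def algebra_simps)
  qed
  finally show ?thesis
    by (simp add: algebra_simps)
qed

lemma eta_nonzero:
  fixes a x :: "'a::real_inner"
  assumes "a \<noteq> 0" "bm < bM" "\<gamma> * \<mu> > 0"
  shows "\<eta> a bm bM x \<mu> \<gamma> \<noteq> 0"
proof -
  define c where "c = \<gamma> * \<mu> * (norm a)\<^sup>2"
  define k where "k = scalar_prox bm bM (a \<bullet> x) c"
  have c: "c > 0"
    using assms by (simp add: c_def)
  have "1 + c * barrier_deriv2 bm bM k > 0"
    using barrier_deriv2_nonneg[of bm bM k] c by (simp add: add_pos_nonneg)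
  then show ?thesis
    using scalar_prox(1)[OF assms(2) c, of "a \<bullet> x"] eta_eq[OF assms, of x] by (auto simp: k_def c_def)
qed

text \<open>
  Stated along an arbitrary differentiable motion of \<open>(s, c)\<close> so that it serves both a change of \<open>x\<close>,
  which moves only \<open>s\<close>, and a change of \<open>\<mu>\<close>, which moves only \<open>c\<close>.
\<close>
lemma has_derivative_scalar_prox_along:
  fixes a x :: "'a::real_inner" and S C :: "'b::real_normed_vector \<Rightarrow> real"
  assumes "a \<noteq> 0" "bm < bM" "\<gamma> * \<mu> > 0"
    and S: "(S has_derivative S') (at w)" "S w = a \<bullet> x"
    and C: "(C has_derivative C') (at w)" "C w = \<gamma> * \<mu> * (norm a)\<^sup>2"
  defines "k \<equiv> \<kappa> a bm bM x \<mu> \<gamma>"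
  shows "((\<lambda>y. scalar_prox bm bM (S y) (C y)) has_derivative
           (\<lambda>h. ((bM - k) * (bm - k) * S' h - (bm + bM - 2 * k) * C' h) / \<eta> a bm bM x \<mu> \<gamma>)) (at w)"
proof -
  define c where "c = \<gamma> * \<mu> * (norm a)\<^sup>2"
  define D where "D = 1 + c * barrier_deriv2 bm bM k"
  have c: "c > 0"
    using assms by (simp add: c_def)
  have k_eq: "k = scalar_prox bm bM (a \<bullet> x) c"
    by (simp add: k_def kappa_eq_scalar_prox c_def)
  have k: "k \<noteq> bm" "k \<noteq> bM"
    using scalar_prox(1)[OF assms(2) c, of "a \<bullet> x"] by (auto simp: k_eq)
  have eta: "\<eta> a bm bM x \<mu> \<gamma> = (bM - k) * (bm - k) * D"
    using eta_eq[OF assms(1-3), of x] by (simp add: k_eq D_def c_def)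
  have SC: "((\<lambda>y. (S y, C y)) has_derivative (\<lambda>h. (S' h, C' h))) (at w)"
    by (intro has_derivative_Pair S C)
  have "((\<lambda>p. scalar_prox bm bM (fst p) (snd p)) has_derivative
      (\<lambda>(ds, dc). (ds - barrier_deriv bm bM k * dc) / D)) (at (S w, C w))"
    using has_derivative_scalar_prox[OF assms(2) c, of "a \<bullet> x"]
    unfolding S(2) C(2) k_eq D_def c_def .
  from has_derivative_compose[OF SC this]
  have "((\<lambda>y. scalar_prox bm bM (S y) (C y)) has_derivative
      (\<lambda>h. (S' h - barrier_deriv bm bM k * C' h) / D)) (at w)"
    by simp
  moreover have "(S' h - barrier_deriv bm bM k * C' h) / D =
      ((bM - k) * (bm - k) * S' h - (bm + bM - 2 * k) * C' h) / \<eta> a bm bM x \<mu> \<gamma>" for h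
  proof -
    have "bm + bM - 2 * k = (bM - k) * (bm - k) * barrier_deriv bm bM k"
      using k by (simp add: barrier_deriv_def divide_simps) (simp add: algebra_simps)
    then have "(bM - k) * (bm - k) * S' h - (bm + bM - 2 * k) * C' h
        = ((bM - k) * (bm - k)) * (S' h - barrier_deriv bm bM k * C' h)"
      by (simp add: right_diff_distrib mult.assoc)
    then show ?thesis
      unfolding eta using k by simp
  qed
  ultimately show ?thesis
    by simp
qed

lemma has_derivative_phi:
  fixes a x :: "'a::real_inner"
  assumes "a \<noteq> 0" "bm < bM" "\<gamma> * \<mu> > 0"
  defines "k \<equiv> \<kappa> a bm bM x \<mu> \<gamma>"
  shows "((\<lambda>y. \<phi> a bm bM y \<mu> \<gamma>) has_derivative
           (\<lambda>h. h + ((1 / (norm a)\<^sup>2) * ((bM - k) * (bm - k) / \<eta> a bm bM x \<mu> \<gamma> - 1) * (a \<bullet> h)) *\<^sub>R a))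
         (at x)"
proof -
  have inner: "((\<lambda>y. a \<bullet> y) has_derivative (\<lambda>h. a \<bullet> h)) (at x)"
    by (intro bounded_linear_imp_has_derivative bounded_linear_inner_right)
  note kappa = has_derivative_scalar_prox_along[OF assms(1-3) inner refl has_derivative_const refl]
  have "((\<lambda>y. y + ((scalar_prox bm bM (a \<bullet> y) (\<gamma> * \<mu> * (norm a)\<^sup>2) - a \<bullet> y) / (norm a)\<^sup>2) *\<^sub>R a) has_derivative
      (\<lambda>h. h + ((((bM - k) * (bm - k) * (a \<bullet> h) - (bm + bM - 2 * k) * 0) / \<eta> a bm bM x \<mu> \<gamma> - a \<bullet> h)
        / (norm a)\<^sup>2) *\<^sub>R a)) (at x)"
    unfolding k_def
    by (intro has_derivative_add has_derivative_ident has_derivative_scaleR_left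
        bounded_linear.has_derivative[OF bounded_linear_divide] has_derivative_diff kappa inner)
  moreover have "(((bM - k) * (bm - k) * (a \<bullet> h) - (bm + bM - 2 * k) * 0) / \<eta> a bm bM x \<mu> \<gamma> - a \<bullet> h)
        / (norm a)\<^sup>2
      = (1 / (norm a)\<^sup>2) * ((bM - k) * (bm - k) / \<eta> a bm bM x \<mu> \<gamma> - 1) * (a \<bullet> h)" for h
    by (simp add: left_diff_distrib diff_divide_distrib)
  ultimately show ?thesis
    by (simp only: phi_eq[OF assms(1-3)])
qed

lemma has_vector_derivative_phi_mu:
  fixes a x :: "'a::real_inner"
  assumes "a \<noteq> 0" "bm < bM" "\<gamma> > 0" "\<mu> > 0"
  defines "k \<equiv> \<kappa> a bm bM x \<mu> \<gamma>"
  shows "((\<lambda>m. \<phi> a bm bM x m \<gamma>) has_vector_derivative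
           (- \<gamma> * (bm + bM - 2 * k) / \<eta> a bm bM x \<mu> \<gamma>) *\<^sub>R a) (at \<mu>)"
proof -
  have pos: "\<gamma> * \<mu> > 0"
    using assms by simp
  have na: "norm a \<noteq> 0"
    using assms by simp
  have c_lin: "((\<lambda>m. \<gamma> * m * (norm a)\<^sup>2) has_derivative (\<lambda>h. \<gamma> * h * (norm a)\<^sup>2)) (at \<mu>)"
    by (intro has_derivative_mult_left has_derivative_mult_right has_derivative_ident)
  note kappa = has_derivative_scalar_prox_along[OF assms(1,2) pos has_derivative_const refl c_lin refl, of x]
  have "((\<lambda>m. x + ((scalar_prox bm bM (a \<bullet> x) (\<gamma> * m * (norm a)\<^sup>2) - a \<bullet> x) / (norm a)\<^sup>2) *\<^sub>R a) has_derivative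
      (\<lambda>h. 0 + ((((bM - k) * (bm - k) * 0 - (bm + bM - 2 * k) * (\<gamma> * h * (norm a)\<^sup>2)) / \<eta> a bm bM x \<mu> \<gamma> - 0)
        / (norm a)\<^sup>2) *\<^sub>R a)) (at \<mu>)"
    unfolding k_def
    by (intro has_derivative_add has_derivative_const has_derivative_scaleR_left
        bounded_linear.has_derivative[OF bounded_linear_divide] has_derivative_diff kappa)
  moreover have "(((bM - k) * (bm - k) * 0 - (bm + bM - 2 * k) * (\<gamma> * h * (norm a)\<^sup>2)) / \<eta> a bm bM x \<mu> \<gamma> - 0)
        / (norm a)\<^sup>2 = h * (- \<gamma> * (bm + bM - 2 * k) / \<eta> a bm bM x \<mu> \<gamma>)" for h
    using na by simp
  ultimately have "((\<lambda>m. x + ((scalar_prox bm bM (a \<bullet> x) (\<gamma> * m * (norm a)\<^sup>2) - a \<bullet> x) / (norm a)\<^sup>2) *\<^sub>R a)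
      has_vector_derivative (- \<gamma> * (bm + bM - 2 * k) / \<eta> a bm bM x \<mu> \<gamma>) *\<^sub>R a) (at \<mu>)"
    unfolding has_vector_derivative_def by simp
  then show ?thesis
    by (rule has_vector_derivative_transform_within_open[where S = "{0<..}"])
      (use assms in \<open>simp_all add: phi_eq\<close>)
qed

lemma phi_swap: "\<phi> a bm bM x \<mu> \<gamma> = \<phi> a bm bM x \<gamma> \<mu>"
  by (simp add: \<phi>_def mult.commute)

lemma kappa_swap: "\<kappa> a bm bM x \<mu> \<gamma> = \<kappa> a bm bM x \<gamma> \<mu>"
  by (simp add: kappa_eq_scalar_prox mult.commute)

lemma eta_swap: "\<eta> a bm bM x \<mu> \<gamma> = \<eta> a bm bM x \<gamma> \<mu>"
  by (simp add: \<eta>_def kappa_swap[of a bm bM x \<mu> \<gamma>] Let_def mult_ac)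

lemma matrix_identity_plus_rank_one:
  fixes a :: "real^'n"
  shows "matrix (\<lambda>h. h + (q * (a \<bullet> h)) *\<^sub>R a) = mat 1 + q *\<^sub>R (\<chi> i j. a $ i * a $ j)"
  by (simp add: vec_eq_iff matrix_def mat_def axis_def inner_axis[unfolded axis_def])

theorem proposition2:
  fixes a :: "real^'n" and bm bM \<gamma> \<mu> :: real
  assumes "a \<noteq> 0" and "bm < bM" and "\<gamma> > 0" and "\<mu> > 0"
  shows "\<forall>x :: real^'n.
    (\<exists>!u. is_arg_min (prox_objective (\<gamma> * \<mu>) (hyperslab_barrier a bm bM) x) (\<lambda>_. True) u)
    \<and> (\<exists>!z. z \<in> {bm<..<bM} \<and> 0 = hyperslab_cubic a bm bM x \<mu> \<gamma> z)
    \<and> \<phi> a bm bM x \<mu> \<gamma> = x + ((\<kappa> a bm bM x \<mu> \<gamma> - a \<bullet> x) / (norm a)\<^sup>2) *\<^sub>R a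
    \<and> \<eta> a bm bM x \<mu> \<gamma> \<noteq> 0
    \<and> (\<lambda>y. \<phi> a bm bM y \<mu> \<gamma>) differentiable (at x)
    \<and> jacobian (\<lambda>y. \<phi> a bm bM y \<mu> \<gamma>) (at x) =
        mat 1 + ((1 / (norm a)\<^sup>2) *
          ((bM - \<kappa> a bm bM x \<mu> \<gamma>) * (bm - \<kappa> a bm bM x \<mu> \<gamma>) / \<eta> a bm bM x \<mu> \<gamma> - 1)) *\<^sub>R
          (\<chi> i j. a $ i * a $ j)
    \<and> ((\<lambda>m. \<phi> a bm bM x m \<gamma>) has_vector_derivative
         (- \<gamma> * (bm + bM - 2 * \<kappa> a bm bM x \<mu> \<gamma>) / \<eta> a bm bM x \<mu> \<gamma>) *\<^sub>R a) (at \<mu>)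
    \<and> ((\<lambda>g. \<phi> a bm bM x \<mu> g) has_vector_derivative
         (- \<mu> * (bm + bM - 2 * \<kappa> a bm bM x \<mu> \<gamma>) / \<eta> a bm bM x \<mu> \<gamma>) *\<^sub>R a) (at \<gamma>)"
proof (intro allI conjI)
  fix x :: "real^'n"
  have pos: "\<gamma> * \<mu> > 0" and c: "\<gamma> * \<mu> * (norm a)\<^sup>2 > 0"
    using assms by simp_all
  note phi = has_derivative_phi[OF assms(1,2) pos, of x]
  show "\<exists>!u. is_arg_min (prox_objective (\<gamma> * \<mu>) (hyperslab_barrier a bm bM) x) (\<lambda>_. True) u"
    by (simp add: is_arg_min_iff_eq_phi[OF assms(1,2) pos])
  show "\<exists>!z. z \<in> {bm<..<bM} \<and> 0 = hyperslab_cubic a bm bM x \<mu> \<gamma> z"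
    using ex1_critical_point[OF assms(2) c, of "a \<bullet> x"] hyperslab_cubic_root_iff by (metis (no_types, lifting))
  show "\<phi> a bm bM x \<mu> \<gamma> = x + ((\<kappa> a bm bM x \<mu> \<gamma> - a \<bullet> x) / (norm a)\<^sup>2) *\<^sub>R a"
    by (simp add: phi_eq[OF assms(1,2) pos] kappa_eq_scalar_prox)
  show "\<eta> a bm bM x \<mu> \<gamma> \<noteq> 0"
    by (rule eta_nonzero[OF assms(1,2) pos])
  show "(\<lambda>y. \<phi> a bm bM y \<mu> \<gamma>) differentiable (at x)"
    using phi by (rule differentiableI)
  show "jacobian (\<lambda>y. \<phi> a bm bM y \<mu> \<gamma>) (at x) =
        mat 1 + ((1 / (norm a)\<^sup>2) *
          ((bM - \<kappa> a bm bM x \<mu> \<gamma>) * (bm - \<kappa> a bm bM x \<mu> \<gamma>) / \<eta> a bm bM x \<mu> \<gamma> - 1)) *\<^sub>R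
          (\<chi> i j. a $ i * a $ j)"
    unfolding jacobian_def frechet_derivative_at[OF phi, symmetric]
    by (rule matrix_identity_plus_rank_one)
  show "((\<lambda>m. \<phi> a bm bM x m \<gamma>) has_vector_derivative
         (- \<gamma> * (bm + bM - 2 * \<kappa> a bm bM x \<mu> \<gamma>) / \<eta> a bm bM x \<mu> \<gamma>) *\<^sub>R a) (at \<mu>)"
    by (rule has_vector_derivative_phi_mu[OF assms])
  show "((\<lambda>g. \<phi> a bm bM x \<mu> g) has_vector_derivative
         (- \<mu> * (bm + bM - 2 * \<kappa> a bm bM x \<mu> \<gamma>) / \<eta> a bm bM x \<mu> \<gamma>) *\<^sub>R a) (at \<gamma>)"
    \<comment> \<open>Only the product of \<open>\<mu>\<close> and \<open>\<gamma>\<close> matters, so they may exchange roles.\<close>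
    using has_vector_derivative_phi_mu[OF assms(1,2,4,3), of x]
    by (simp add: phi_swap[of a bm bM x \<mu>] kappa_swap[of a bm bM x \<mu>] eta_swap[of a bm bM x \<mu>])
qed

end
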